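(* In the setting of the context (with $\mu>0$), let Algorithm I and Algorithm II be run from the same $x^{(0)}\in\mathrm{dom}(\Psi)$ and with the same sequence of (randomly chosen) block indices $i_0,i_1,i_2,\dots\in\{1,\dots,n\}$. Then the iterates $x^{(k)},y^{(k)},z^{(k)}$ of Algorithm I and the iterates $u^{(k)},v^{(k)}$ of Algorithm II satisfy, for all $k\ge0$, $$x^{(k)}=\rho^ku^{(k)}+v^{(k)},\qquad y^{(k)}=\rho^{k+1}u^{(k)}+v^{(k)},\qquad z^{(k)}=-\rho^ku^{(k)}+v^{(k)}.$$ That is, these two algorithms are equivalent.
   Context: Setting. $\mathbb{R}^N$ is partitioned into $n$ blocks: $x\in\mathbb{R}^N$ has sub-vectors $x_i\in\mathbb{R}^{N_i}$, $i=1,\dots,n$, $\sum_iN_i=N$, and $U=[U_1\cdots U_n]$ is an $N\times N$ permutation matrix with $U_i\in\mathbb{R}^{N\times N_i}$ such that $x=\sum_iU_ix_i$ and $x_i=U_i^Tx$. The problem is to minimize $f(x)+\Psi(x)$ over $x\in\mathbb{R}^N$, where $f$ and $\Psi$ are proper lower semicontinuous convex functions, $f$ is differentiable on $\mathbb{R}^N$ with partial gradients $\nabla_if(x)=U_i^T\nabla f(x)$, and $\Psi(x)=\sum_{i=1}^n\Psi_i(x_i)$. Constants $L_i>0$ satisfy $\|\nabla_if(x+U_ih_i)-\nabla_if(x)\|_2\le L_i\|h_i\|_2$ for all $x\in\mathbb{R}^N$, $h_i\in\mathbb{R}^{N_i}$, $i=1,\dots,n$; $\|x\|_L=(\sum_iL_i\|x_i\|_2^2)^{1/2}$;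 and the convexity parameter $\mu>0$ satisfies $f(y)\ge f(x)+\langle\nabla f(x),y-x\rangle+\frac\mu2\|y-x\|_L^2$ for all $y\in\mathbb{R}^N$, $x\in\mathrm{dom}(\Psi)$ (which implies $\mu\le1$). Put $\alpha=\sqrt\mu/n$ and $\rho=\frac{1-\alpha}{1+\alpha}$. Algorithm I (accelerated proximal coordinate gradient method, strongly convex case). Input $x^{(0)}\in\mathrm{dom}(\Psi)$; set $z^{(0)}=x^{(0)}$. For $k=0,1,2,\dots$: (1) $y^{(k)}=\frac{x^{(k)}+\alpha z^{(k)}}{1+\alpha}$; (2) choose $i_k\in\{1,\dots,n\}$ uniformly at random and set $z^{(k+1)}=\arg\min_{x\in\mathbb{R}^N}\big\{\frac{n\alpha}{2}\|x-(1-\alpha)z^{(k)}-\alpha y^{(k)}\|_L^2+\langle\nabla_{i_k}f(y^{(k)}),x_{i_k}-y^{(k)}_{i_k}\rangle+\Psi_{i_k}(x_{i_k})\big\}$; (3) $x^{(k+1)}=y^{(k)}+n\alpha(z^{(k+1)}-z^{(k)})+n\alpha^2(z^{(k)}-y^{(k)})$. Algorithm II (efficient implementation). Input $x^{(0)}\in\mathrm{dom}(\Psi)$; set $u^{(0)}=0$, $v^{(0)}=x^{(0)}$. For $k=0,1,2,\dots$: (1) choose $i_k\in\{1,\dots,n\}$ uniformly at random and set $h^{(k)}_{i_k}=\arg\min_{h\in\mathbb{R}^{N_{i_k}}}\big\{\frac{n\alpha L_{i_k}}{2}\|h\|_2^2+\langle\nabla_{i_k}f(\rho^{k+1}u^{(k)}+v^{(k)}),h\rangle+\Psi_{i_k}(-\rho^{k+1}u^{(k)}_{i_k}+v^{(k)}_{i_k}+h)\big\}$;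 (2) let $u^{(k+1)}=u^{(k)}$, $v^{(k+1)}=v^{(k)}$ except in block $i_k$, where $u^{(k+1)}_{i_k}=u^{(k)}_{i_k}-\frac{1-n\alpha}{2\rho^{k+1}}h^{(k)}_{i_k}$ and $v^{(k+1)}_{i_k}=v^{(k)}_{i_k}+\frac{1+n\alpha}{2}h^{(k)}_{i_k}$. The output after iteration $k$ is $x^{(k+1)}=\rho^{k+1}u^{(k+1)}+v^{(k+1)}$. *)

theory Defs
  imports "HOL-Analysis.Analysis" "Jordan_Normal_Form.Matrix"
begin

(* Both libraries use "$" for vector components; below it is the one for the
   vectors of variable dimension in Jordan_Normal_Form. *)
unbundle no vec_syntax

(* Extended-real-valued functions *)

definition proper_fun :: "('a \<Rightarrow> ereal) \<Rightarrow> bool" where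
  "proper_fun F \<longleftrightarrow> (\<forall>x. F x \<noteq> -\<infinity>) \<and> (\<exists>x. F x < \<infinity>)"

definition effective_domain :: "('a \<Rightarrow> ereal) \<Rightarrow> 'a set" where
  "effective_domain F = {x. F x < \<infinity>}"

definition lsc_fun :: "('a::topological_space \<Rightarrow> ereal) \<Rightarrow> bool" where
  "lsc_fun F \<longleftrightarrow> (\<forall>x. F x \<le> Liminf (at x) F)"

(* Convexity of the epigraph; this also makes sense where F takes infinite values. *)
definition convex_fun :: "('a::real_vector \<Rightarrow> ereal) \<Rightarrow> bool" where
  "convex_fun F \<longleftrightarrow> convex {(x, r::real). F x \<le> ereal r}"

(* Block structure.  The whole space is real^'N with the blocks numbered 1, ..., n.
   Since the block dimensions N i vary with i, a sub-vector in R^(N i) is an element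
   of carrier_vec (N i).  The matrix U_i is given by its columns: U i j, for j < N i,
   is column number j of U_i, a vector in real^'N. *)

(* A square matrix is a permutation matrix iff its columns are the standard unit
   vectors, each occurring exactly once; in particular the N i add up to CARD('N). *)
definition block_permutation ::
    "nat \<Rightarrow> (nat \<Rightarrow> nat) \<Rightarrow> (nat \<Rightarrow> nat \<Rightarrow> real ^ 'N) \<Rightarrow> bool" where
  "block_permutation n N U \<longleftrightarrow>
     bij_betw (\<lambda>(i, j). U i j) (SIGMA i:{1..n}. {..<N i}) (range (\<lambda>m. axis m 1))"

(* U_i^T x *)
definition subvec ::
    "(nat \<Rightarrow> nat) \<Rightarrow> (nat \<Rightarrow> nat \<Rightarrow> real ^ 'N) \<Rightarrow> nat \<Rightarrow> real ^ 'N \<Rightarrow> real Matrix.vec" where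
  "subvec N U i x = Matrix.vec (N i) (\<lambda>j. inner (U i j) x)"

(* U_i h *)
definition embed_block ::
    "(nat \<Rightarrow> nat) \<Rightarrow> (nat \<Rightarrow> nat \<Rightarrow> real ^ 'N) \<Rightarrow> nat \<Rightarrow> real Matrix.vec \<Rightarrow> real ^ 'N" where
  "embed_block N U i h = (\<Sum>j<N i. (h $ j) *\<^sub>R U i j)"

definition norm2 :: "real Matrix.vec \<Rightarrow> real" where
  "norm2 h = sqrt (h \<bullet> h)"

definition normL ::
    "nat \<Rightarrow> (nat \<Rightarrow> nat) \<Rightarrow> (nat \<Rightarrow> nat \<Rightarrow> real ^ 'N) \<Rightarrow> (nat \<Rightarrow> real) \<Rightarrow> real ^ 'N \<Rightarrow> real" where
  "normL n N U L x = sqrt (\<Sum>i=1..n. L i * (norm2 (subvec N U i x))\<^sup>2)"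

definition step_alpha :: "nat \<Rightarrow> real \<Rightarrow> real" where
  "step_alpha n \<mu> = sqrt \<mu> / real n"

definition step_rho :: "nat \<Rightarrow> real \<Rightarrow> real" where
  "step_rho n \<mu> = (1 - step_alpha n \<mu>) / (1 + step_alpha n \<mu>)"

(* The two algorithms, as predicates saying that the given sequences form a run with
   starting point x0 and chosen block indices i 0, i 1, ...  Here G is the gradient of
   f and \<psi> i the i-th summand of the separable term. *)

definition algorithm_I ::
    "nat \<Rightarrow> (nat \<Rightarrow> nat) \<Rightarrow> (nat \<Rightarrow> nat \<Rightarrow> real ^ 'N) \<Rightarrow> (real ^ 'N \<Rightarrow> real ^ 'N) \<Rightarrow>
     (nat \<Rightarrow> real Matrix.vec \<Rightarrow> ereal) \<Rightarrow> (nat \<Rightarrow> real) \<Rightarrow> real \<Rightarrow> real ^ 'N \<Rightarrow> (nat \<Rightarrow> nat) \<Rightarrow>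
     (nat \<Rightarrow> real ^ 'N) \<Rightarrow> (nat \<Rightarrow> real ^ 'N) \<Rightarrow> (nat \<Rightarrow> real ^ 'N) \<Rightarrow> bool" where
  "algorithm_I n N U G \<psi> L \<mu> x0 i x y z \<longleftrightarrow>
     (let \<alpha> = step_alpha n \<mu> in
        x 0 = x0 \<and> z 0 = x0 \<and>
        (\<forall>k. y k = (1 / (1 + \<alpha>)) *\<^sub>R (x k + \<alpha> *\<^sub>R z k) \<and>
             is_arg_min
               (\<lambda>w. ereal (real n * \<alpha> / 2 *
                            (normL n N U L (w - (1 - \<alpha>) *\<^sub>R z k - \<alpha> *\<^sub>R y k))\<^sup>2
                          + subvec N U (i k) (G (y k)) \<bullet>
                              (subvec N U (i k) w - subvec N U (i k) (y k)))
                    + \<psi> (i k) (subvec N U (i k) w))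
               (\<lambda>w. True) (z (Suc k)) \<and>
             x (Suc k) = y k + (real n * \<alpha>) *\<^sub>R (z (Suc k) - z k)
                             + (real n * \<alpha>\<^sup>2) *\<^sub>R (z k - y k)))"

(* If n = 1 and \<mu> = 1, then \<rho> = 0 and the coefficient of h k in the update of u reads
   0 / 0, which is 0 here. *)
definition algorithm_II ::
    "nat \<Rightarrow> (nat \<Rightarrow> nat) \<Rightarrow> (nat \<Rightarrow> nat \<Rightarrow> real ^ 'N) \<Rightarrow> (real ^ 'N \<Rightarrow> real ^ 'N) \<Rightarrow>
     (nat \<Rightarrow> real Matrix.vec \<Rightarrow> ereal) \<Rightarrow> (nat \<Rightarrow> real) \<Rightarrow> real \<Rightarrow> real ^ 'N \<Rightarrow> (nat \<Rightarrow> nat) \<Rightarrow>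
     (nat \<Rightarrow> real Matrix.vec) \<Rightarrow> (nat \<Rightarrow> real ^ 'N) \<Rightarrow> (nat \<Rightarrow> real ^ 'N) \<Rightarrow> bool" where
  "algorithm_II n N U G \<psi> L \<mu> x0 i h u v \<longleftrightarrow>
     (let \<alpha> = step_alpha n \<mu>; \<rho> = step_rho n \<mu> in
        u 0 = 0 \<and> v 0 = x0 \<and>
        (\<forall>k. is_arg_min
               (\<lambda>d. ereal (real n * \<alpha> * L (i k) / 2 * (norm2 d)\<^sup>2
                          + subvec N U (i k) (G (\<rho> ^ Suc k *\<^sub>R u k + v k)) \<bullet> d)
                    + \<psi> (i k) ((- (\<rho> ^ Suc k)) \<cdot>\<^sub>v subvec N U (i k) (u k)
                                + subvec N U (i k) (v k) + d))
               (\<lambda>d. d \<in> carrier_vec (N (i k))) (h k) \<and>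
             (\<forall>j\<in>{1..n}.
                subvec N U j (u (Suc k)) =
                  (if j = i k
                   then subvec N U j (u k) - ((1 - real n * \<alpha>) / (2 * \<rho> ^ Suc k)) \<cdot>\<^sub>v h k
                   else subvec N U j (u k)) \<and>
                subvec N U j (v (Suc k)) =
                  (if j = i k
                   then subvec N U j (v k) + ((1 + real n * \<alpha>) / 2) \<cdot>\<^sub>v h k
                   else subvec N U j (v k)))))"

end

theory Submission
  imports Defs
begin

text \<open>Put \<open>c = (1 - \<alpha>) z\<^sub>k + \<alpha> y\<^sub>k\<close>. If the three identities hold at \<open>k\<close>, then
  \<open>(1 - \<alpha>) = \<rho> (1 + \<alpha>)\<close> gives \<open>c = - \<rho>^(k+1) u\<^sub>k + v\<^sub>k\<close>, so that up to an additive constant the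
  objective of Algorithm II is that of Algorithm I restricted to \<open>c + U\<^sub>i h\<close>. The latter is
  strongly convex and its minimizer lies in this affine subspace, hence the new \<open>z\<close> is \<open>c + U\<^sub>i h\<^sub>k\<close>, and the
  identities at \<open>k + 1\<close> are linear algebra. The one division to worry about is by \<open>\<rho>^(k+1)\<close>: the
  descent lemma along a coordinate yields \<open>\<mu> \<le> 1\<close>, so \<open>\<rho> = 0\<close> forces \<open>n = 1\<close> and \<open>\<mu> = 1\<close>.\<close>

unbundle no inner_syntax

section \<open>Blocks\<close>

lemma block_permutation_surj:
  assumes "block_permutation n N U"
  obtains i j where "i \<in> {1..n}" "j < N i" "U i j = axis m 1"
proof -
  have "axis m 1 \<in> (\<lambda>(i, j). U i j) ` (SIGMA i:{1..n}. {..<N i})"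
    using assms unfolding block_permutation_def bij_betw_def by auto
  then show thesis
    using that by auto
qed

text \<open>Bijectivity makes the columns distinct standard unit vectors, hence orthonormal. This is
  \<open>U\<^sup>T U = I\<close> in terms of columns.\<close>

lemma inner_block_permutation:
  assumes "block_permutation n N U"
    and "i \<in> {1..n}" "j < N i" "i' \<in> {1..n}" "j' < N i'"
  shows "inner (U i j) (U i' j') = (if i = i' \<and> j = j' then 1 else 0)"
proof -
  let ?S = "SIGMA i:{1..n}. {..<N i}"
  have bij: "bij_betw (\<lambda>(i, j). U i j) ?S (range (\<lambda>m. axis m 1))"
    using assms(1) unfolding block_permutation_def .
  have mem: "(i, j) \<in> ?S" "(i', j') \<in> ?S"
    using assms by auto
  obtain m where m: "U i j = axis m 1"
    using bspec[OF bij_betwE[OF bij] mem(1)] by auto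
  obtain m' where m': "U i' j' = axis m' 1"
    using bspec[OF bij_betwE[OF bij] mem(2)] by auto
  have "U i j = U i' j' \<longleftrightarrow> i = i' \<and> j = j'"
    using inj_on_eq_iff[OF bij_betw_imp_inj_on[OF bij] mem] by simp
  then have "m = m' \<longleftrightarrow> i = i' \<and> j = j'"
    unfolding m m' by (simp add: axis_eq_axis)
  then show ?thesis
    unfolding m m' by (simp add: inner_axis_axis)
qed

lemma subvec_carrier [simp]: "subvec N U i x \<in> carrier_vec (N i)"
  and dim_subvec [simp]: "dim_vec (subvec N U i x) = N i"
  and subvec_index [simp]: "j < N i \<Longrightarrow> subvec N U i x $ j = inner (U i j) x"
  by (auto simp: subvec_def)

lemma subvec_add: "subvec N U i (x + y) = subvec N U i x + subvec N U i y"
  and subvec_diff: "subvec N U i (x - y) = subvec N U i x - subvec N U i y"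
  and subvec_scaleR: "subvec N U i (c *\<^sub>R x) = c \<cdot>\<^sub>v subvec N U i x"
  by (auto simp: inner_simps)

lemma subvec_scalar_prod:
  "subvec N U i x \<bullet> subvec N U i y = (\<Sum>j<N i. inner (U i j) x * inner (U i j) y)"
  by (auto simp: scalar_prod_def atLeast0LessThan intro!: sum.cong)

text \<open>The columns run through all standard unit vectors, so every coordinate is an entry of
  some sub-vector. This turns the blockwise updates of Algorithm II into equations between whole
  vectors.\<close>

lemma subvec_eqI:
  assumes "block_permutation n N U"
    and "\<And>i. i \<in> {1..n} \<Longrightarrow> subvec N U i x = subvec N U i y"
  shows "x = y"
proof (rule Finite_Cartesian_Product.vec_eq_iff[THEN iffD2, rule_format])
  fix m
  obtain i j where ij: "i \<in> {1..n}" "j < N i" "U i j = axis m 1"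
    using block_permutation_surj[OF assms(1)] .
  have "inner (U i j) x = inner (U i j) y"
    using assms(2)[OF ij(1)] ij(2) by (metis subvec_index)
  then show "vec_nth x m = vec_nth y m"
    unfolding ij(3) by (simp add: inner_axis')
qed

lemma subvec_embed_block:
  assumes "block_permutation n N U" "i \<in> {1..n}" "i' \<in> {1..n}" "d \<in> carrier_vec (N i)"
  shows "subvec N U i' (embed_block N U i d) = (if i' = i then d else 0\<^sub>v (N i'))"
proof (rule eq_vecI)
  fix j assume "j < dim_vec (if i' = i then d else 0\<^sub>v (N i'))"
  then have j: "j < N i'"
    using assms(4) by (auto split: if_splits)
  have "subvec N U i' (embed_block N U i d) $ j
      = (\<Sum>l<N i. d $ l * (if i' = i \<and> j = l then 1 else 0))"
    unfolding subvec_index[of j N i' U, OF j] embed_block_def inner_sum_right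
    by (intro sum.cong refl)
       (simp add: inner_block_permutation[OF assms(1) assms(3) j assms(2)])
  also have "\<dots> = (if i' = i then d else 0\<^sub>v (N i')) $ j"
    using j by (auto simp: if_distrib sum.delta cong: if_cong)
  finally show "subvec N U i' (embed_block N U i d) $ j = \<dots>" .
qed (use assms in auto)

lemma norm2_sq: "(norm2 d)\<^sup>2 = d \<bullet> d"
  by (simp add: norm2_def scalar_prod_def sum_nonneg)

lemma normL_sq:
  assumes "\<And>i. i \<in> {1..n} \<Longrightarrow> L i > 0"
  shows "(normL n N U L x)\<^sup>2 = (\<Sum>i=1..n. L i * (subvec N U i x \<bullet> subvec N U i x))"
proof -
  have "0 \<le> (\<Sum>i=1..n. L i * (norm2 (subvec N U i x))\<^sup>2)"
    using assms by (intro sum_nonneg mult_nonneg_nonneg) (auto simp: less_imp_le)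
  then show ?thesis
    by (simp add: normL_def norm2_sq)
qed

text \<open>The parallelogram law, block by block. The subtracted term is what makes the proximal
  objective strictly convex.\<close>

lemma normL_sq_midpoint:
  assumes "\<And>i. i \<in> {1..n} \<Longrightarrow> L i > 0"
  shows "(normL n N U L ((1/2) *\<^sub>R (x + y)))\<^sup>2
    = ((normL n N U L x)\<^sup>2 + (normL n N U L y)\<^sup>2) / 2 - (normL n N U L (x - y))\<^sup>2 / 4"
proof -
  have *: "a \<bullet> a = (b \<bullet> b + c \<bullet> c) / 2 - e \<bullet> e / 4"
    if "a = subvec N U i ((1/2) *\<^sub>R (x + y))" "b = subvec N U i x" "c = subvec N U i y"
      "e = subvec N U i (x - y)" for a b c e i
    unfolding that subvec_scalar_prod sum.distrib[symmetric] sum_divide_distrib sum_subtractf[symmetric]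
    by (intro sum.cong refl) (simp add: inner_simps field_simps)
  have sq: "(normL n N U L w)\<^sup>2 = (\<Sum>i=1..n. L i * (subvec N U i w \<bullet> subvec N U i w))" for w
    using assms by (rule normL_sq)
  show ?thesis
    unfolding sq *[OF refl refl refl refl]
      sum.distrib[symmetric] sum_divide_distrib sum_subtractf[symmetric]
    by (intro sum.cong refl) (simp add: field_simps)
qed

text \<open>If the squared norm vanished, positivity of the weights would kill every entry of every
  block, and the blocks cover all coordinates.\<close>

lemma normL_sq_pos:
  assumes "block_permutation n N U" "\<And>i. i \<in> {1..n} \<Longrightarrow> L i > 0" "x \<noteq> 0"
  shows "(normL n N U L x)\<^sup>2 > 0"
proof (rule ccontr)
  assume "\<not> ?thesis"
  then have z: "(\<Sum>i=1..n. L i * (\<Sum>j<N i. (inner (U i j) x)\<^sup>2)) = 0"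
    using zero_le_power2[of "normL n N U L x"] normL_sq[of n L N U x, OF assms(2)]
    by (simp add: subvec_scalar_prod power2_eq_square)
  have "x = 0"
  proof (rule subvec_eqI[OF assms(1)])
    fix i assume i: "i \<in> {1..n}"
    have "L i * (\<Sum>j<N i. (inner (U i j) x)\<^sup>2) = 0"
      using z i assms(2)
      by (subst (asm) sum_nonneg_eq_0_iff) (auto simp: less_imp_le intro!: mult_nonneg_nonneg sum_nonneg)
    then have "\<forall>j<N i. inner (U i j) x = 0"
      using assms(2)[OF i] by (auto simp: sum_nonneg_eq_0_iff)
    then show "subvec N U i x = subvec N U i 0"
      by auto
  qed
  with assms(3) show False by simp
qed

lemma normL_sq_embed_block:
  assumes "block_permutation n N U" "\<And>i. i \<in> {1..n} \<Longrightarrow> L i > 0"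
    and "i \<in> {1..n}" "d \<in> carrier_vec (N i)"
  shows "(normL n N U L (embed_block N U i d))\<^sup>2 = L i * (d \<bullet> d)"
proof -
  have "(normL n N U L (embed_block N U i d))\<^sup>2 = (\<Sum>j=1..n. if j = i then L i * (d \<bullet> d) else 0)"
    using assms(2)
    by (subst normL_sq, simp, intro sum.cong refl) (auto simp: subvec_embed_block[OF assms(1,3) _ assms(4)])
  then show ?thesis
    using assms(3) by simp
qed

text \<open>The other blocks contribute nonnegative terms. Together with equality on vectors
  supported in block \<open>i\<close> (\<open>normL_sq_embed_block\<close>), it shows that moving
  any other block only increases the proximal term.\<close>

lemma normL_sq_ge_block:
  assumes "\<And>i. i \<in> {1..n} \<Longrightarrow> L i > 0" "i \<in> {1..n}"
  shows "L i * (subvec N U i x \<bullet> subvec N U i x) \<le> (normL n N U L x)\<^sup>2"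
  using assms
  by (subst normL_sq, simp, intro member_le_sum[where f = "\<lambda>i. L i * (subvec N U i x \<bullet> subvec N U i x)"])
     (auto simp: subvec_scalar_prod less_imp_le intro!: mult_nonneg_nonneg[of "L _"] sum_nonneg)

section \<open>The convexity parameter\<close>

text \<open>Along one coordinate direction of block \<open>i\<close>, the Lipschitz bound gives
  growth at most \<open>L i / 2\<close> beyond the linear part, while strong convexity gives at
  least \<open>\<mu> * L i / 2\<close>. The strong convexity inequality is asked for at a single
  point \<open>w\<close>, since it is available only on the domain of \<open>\<Psi>\<close>.\<close>

lemma convexity_parameter_le_1:
  fixes f :: "real ^ 'N \<Rightarrow> real"
  assumes blocks: "block_permutation n N U"
    and grad: "\<And>w. GDERIV f w :> G w"
    and L_pos: "\<And>j. j \<in> {1..n} \<Longrightarrow> L j > 0"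
    and lip: "\<And>j w d. j \<in> {1..n} \<Longrightarrow> d \<in> carrier_vec (N j) \<Longrightarrow>
           norm2 (subvec N U j (G (w + embed_block N U j d)) - subvec N U j (G w)) \<le> L j * norm2 d"
    and conv: "\<And>w'. f w' \<ge> f w + inner (G w) (w' - w) + \<mu> / 2 * (normL n N U L (w' - w))\<^sup>2"
  shows "\<mu> \<le> 1"
proof -
  \<comment> \<open>The index type is nonempty, so some block has positive dimension and supplies a
    direction.\<close>
  obtain i j where i: "i \<in> {1..n}" and j: "j < N i"
    by (rule block_permutation_surj[OF blocks])
  define e where "e = U i j"
  have embed: "embed_block N U i (t \<cdot>\<^sub>v unit_vec (N i) j) = t *\<^sub>R e" for t
  proof -
    have "embed_block N U i (t \<cdot>\<^sub>v unit_vec (N i) j) = (\<Sum>l<N i. if l = j then t *\<^sub>R e else 0)"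
      unfolding embed_block_def e_def using j
      by (intro sum.cong refl) (auto simp: unit_vec_def)
    then show ?thesis
      using j by simp
  qed
  have uu: "(t \<cdot>\<^sub>v unit_vec (N i) j) \<bullet> (t \<cdot>\<^sub>v unit_vec (N i) j) = t\<^sup>2" for t :: real
    using j by (simp add: power2_eq_square)
  \<comment> \<open>The derivative along \<open>e\<close> is entry \<open>j\<close> of the partial
    gradient, and one entry is bounded by the norm of the block.\<close>
  have slope: "inner (G (w + t *\<^sub>R e)) e - inner (G w) e \<le> L i * t" if "t \<ge> 0" for t
  proof -
    let ?g = "subvec N U i (G (w + t *\<^sub>R e)) - subvec N U i (G w)"
    have "(?g $ j)\<^sup>2 \<le> ?g \<bullet> ?g"
      unfolding scalar_prod_def power2_eq_square using j
      by (intro member_le_sum[where f = "\<lambda>l. ?g $ l * ?g $ l"]) auto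
    then have "\<bar>?g $ j\<bar> \<le> norm2 ?g"
      unfolding norm2_def by (metis real_sqrt_abs real_sqrt_le_mono)
    also have "\<dots> \<le> L i * norm2 (t \<cdot>\<^sub>v unit_vec (N i) j)"
      using lip[OF i, of "t \<cdot>\<^sub>v unit_vec (N i) j" w] unfolding embed by simp
    also have "\<dots> = L i * t"
      unfolding norm2_def uu using that by simp
    finally show ?thesis
      using j by (simp add: e_def inner_commute)
  qed
  \<comment> \<open>The descent lemma without integration: by \<open>slope\<close> the derivative of
    \<open>\<phi>\<close> is nonpositive for \<open>t \<ge> 0\<close>, and
    \<open>\<phi> 1 \<le> \<phi> 0\<close> is the quadratic upper bound for a unit step along
    \<open>e\<close>.\<close>
  define \<phi> where "\<phi> t = f (w + t *\<^sub>R e) - t * inner (G w) e - L i * t\<^sup>2 / 2" for t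
  have "(\<phi> has_real_derivative inner (G (w + t *\<^sub>R e)) e - inner (G w) e - L i * t) (at t)" for t
  proof -
    have "(f has_derivative (\<lambda>d. inner d (G (w + t *\<^sub>R e)))) (at (w + t *\<^sub>R e))"
      using grad unfolding gderiv_def .
    moreover have "((\<lambda>t. w + t *\<^sub>R e) has_derivative (\<lambda>s. s *\<^sub>R e)) (at t)"
      by (auto intro!: derivative_eq_intros)
    ultimately have "((\<lambda>t. f (w + t *\<^sub>R e)) has_derivative (\<lambda>s. inner (s *\<^sub>R e) (G (w + t *\<^sub>R e)))) (at t)"
      using has_derivative_compose by fastforce
    then have "((\<lambda>t. f (w + t *\<^sub>R e)) has_real_derivative inner (G (w + t *\<^sub>R e)) e) (at t)"
      unfolding has_field_derivative_def
      by (rule has_derivative_eq_rhs) (auto simp: inner_commute mult.commute)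
    then show ?thesis
      unfolding \<phi>_def by (auto intro!: derivative_eq_intros)
  qed
  then have "\<phi> 1 \<le> \<phi> 0"
    using slope by (intro DERIV_nonpos_imp_nonincreasing[of 0 1 \<phi>]) (auto intro!: exI)
  then have "f (w + e) \<le> f w + inner (G w) e + L i / 2"
    by (simp add: \<phi>_def)
  moreover have "(normL n N U L e)\<^sup>2 = L i"
    using normL_sq_embed_block[where L = L, OF blocks L_pos i, of "1 \<cdot>\<^sub>v unit_vec (N i) j"]
    unfolding embed uu by simp
  ultimately have "\<mu> / 2 * L i \<le> L i / 2"
    using conv[of "w + e"] by simp
  then show ?thesis
    using L_pos[OF i] by simp
qed

section \<open>The separable term\<close>

text \<open>Properness and convexity are assumed for \<open>\<Psi>\<close> only. Replacing block
  \<open>i\<close> of a fixed \<open>w0\<close> in the domain by that of \<open>w\<close> freezes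
  the other summands at a finite constant, so these properties pass to
  \<open>\<psi> i\<close>.\<close>

lemma separable_term_block:
  fixes \<Psi> :: "real ^ 'N \<Rightarrow> ereal"
  assumes blocks: "block_permutation n N U"
    and proper: "proper_fun \<Psi>"
    and sep: "\<And>w. \<Psi> w = (\<Sum>j=1..n. \<psi> j (subvec N U j w))"
    and w0: "w0 \<in> effective_domain \<Psi>"
    and i: "i \<in> {1..n}"
  obtains C :: real where
    "\<And>w. \<Psi> (w0 + embed_block N U i (subvec N U i (w - w0))) = \<psi> i (subvec N U i w) + ereal C"
proof -
  have "\<bar>\<Psi> w0\<bar> \<noteq> \<infinity>"
    using proper w0 unfolding proper_fun_def effective_domain_def by auto
  \<comment> \<open>In \<open>ereal\<close> infinities never cancel to a finite value, so a finite
    sum has only finite summands.\<close>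
  then have fin: "\<bar>\<psi> j (subvec N U j w0)\<bar> \<noteq> \<infinity>" if "j \<in> {1..n}" for j
    using that unfolding sep sum_Inf by auto
  then have "\<bar>\<Sum>j\<in>{1..n} - {i}. \<psi> j (subvec N U j w0)\<bar> \<noteq> \<infinity>"
    unfolding sum_Inf by auto
  then obtain C where C: "(\<Sum>j\<in>{1..n} - {i}. \<psi> j (subvec N U j w0)) = ereal C"
    by auto
  show thesis
  proof
    fix w
    let ?p = "w0 + embed_block N U i (subvec N U i (w - w0))"
    have p: "subvec N U j ?p = (if j = i then subvec N U i w else subvec N U j w0)" if "j \<in> {1..n}" for j
      using subvec_embed_block[OF blocks i that subvec_carrier[of N U i "w - w0"]]
      by (auto simp: subvec_add inner_simps)
    have "\<Psi> ?p = \<psi> i (subvec N U i ?p) + (\<Sum>j\<in>{1..n} - {i}. \<psi> j (subvec N U j ?p))"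
      unfolding sep using i by (subst sum.remove[of _ i]) auto
    also have "(\<Sum>j\<in>{1..n} - {i}. \<psi> j (subvec N U j ?p)) = ereal C"
      unfolding C[symmetric] using p by (intro sum.cong) auto
    finally show "\<Psi> ?p = \<psi> i (subvec N U i w) + ereal C"
      using p[OF i] by simp
  qed
qed

text \<open>Substituting block \<open>i\<close> into \<open>w0\<close> is an affine map, so it
  respects midpoints. Convexity of the epigraph of \<open>\<Psi>\<close> then applies to the
  substituted points, and the constant \<open>C\<close> cancels.\<close>

lemma separable_term_midpoint:
  fixes \<Psi> :: "real ^ 'N \<Rightarrow> ereal"
  assumes blocks: "block_permutation n N U"
    and proper: "proper_fun \<Psi>"
    and conv: "convex_fun \<Psi>"
    and sep: "\<And>w. \<Psi> w = (\<Sum>j=1..n. \<psi> j (subvec N U j w))"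
    and w0: "w0 \<in> effective_domain \<Psi>"
    and i: "i \<in> {1..n}"
    and a: "\<psi> i (subvec N U i w1) = ereal a"
    and b: "\<psi> i (subvec N U i w2) = ereal b"
  shows "\<psi> i (subvec N U i ((1/2) *\<^sub>R (w1 + w2))) \<le> ereal ((a + b) / 2)"
proof -
  obtain C where C: "\<And>w. \<Psi> (w0 + embed_block N U i (subvec N U i (w - w0))) = \<psi> i (subvec N U i w) + ereal C"
    using separable_term_block[OF blocks proper sep w0 i] by blast
  define p where "p w = w0 + embed_block N U i (subvec N U i (w - w0))" for w
  have mid: "p ((1/2) *\<^sub>R (w1 + w2)) = (1/2) *\<^sub>R p w1 + (1/2) *\<^sub>R p w2"
  proof -
    have "embed_block N U i (subvec N U i ((1/2) *\<^sub>R (w1 + w2) - w0))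
      = (1/2) *\<^sub>R embed_block N U i (subvec N U i (w1 - w0)) + (1/2) *\<^sub>R embed_block N U i (subvec N U i (w2 - w0))"
      unfolding embed_block_def scaleR_sum_right sum.distrib[symmetric] scaleR_scaleR scaleR_left_distrib[symmetric]
      by (intro sum.cong refl arg_cong2[where f = scaleR]) (simp add: inner_simps field_simps)
    moreover have "w0 = (1/2) *\<^sub>R w0 + (1/2) *\<^sub>R w0"
      by (simp add: scaleR_left_distrib[symmetric])
    ultimately show ?thesis
      unfolding p_def by (simp add: scaleR_right_distrib)
  qed
  have "convex {(x, r). \<Psi> x \<le> ereal r}"
    using conv unfolding convex_fun_def .
  moreover have "(p w1, a + C) \<in> {(x, r). \<Psi> x \<le> ereal r}" "(p w2, b + C) \<in> {(x, r). \<Psi> x \<le> ereal r}"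
    using C[of w1] C[of w2] a b by (simp_all add: p_def)
  ultimately have "(1/2) *\<^sub>R (p w1, a + C) + (1/2) *\<^sub>R (p w2, b + C) \<in> {(x, r). \<Psi> x \<le> ereal r}"
    by (rule convexD) auto
  then have "\<Psi> (p ((1/2) *\<^sub>R (w1 + w2))) \<le> ereal ((a + C) / 2 + (b + C) / 2)"
    by (simp add: mid)
  then show ?thesis
    using C[of "(1/2) *\<^sub>R (w1 + w2)"] unfolding p_def[symmetric]
    by (cases "\<psi> i (subvec N U i ((1/2) *\<^sub>R (w1 + w2)))") (auto simp: field_simps)
qed

lemma separable_term_not_MInfty:
  fixes \<Psi> :: "real ^ 'N \<Rightarrow> ereal"
  assumes "block_permutation n N U" "proper_fun \<Psi>"
    and "\<And>w. \<Psi> w = (\<Sum>j=1..n. \<psi> j (subvec N U j w))"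
    and "w0 \<in> effective_domain \<Psi>" "i \<in> {1..n}"
  shows "\<psi> i (subvec N U i w) \<noteq> -\<infinity>"
proof -
  obtain C where C: "\<And>w. \<Psi> (w0 + embed_block N U i (subvec N U i (w - w0))) = \<psi> i (subvec N U i w) + ereal C"
    using separable_term_block[OF assms] by blast
  show ?thesis
    using C[of w] assms(2) unfolding proper_fun_def by (metis MInfty_neq_PInfty(1) ereal_plus_eq_MInfty PInfty_neq_ereal(1))
qed

lemma separable_term_not_PInfty:
  fixes \<Psi> :: "real ^ 'N \<Rightarrow> ereal"
  assumes sep: "\<And>w. \<Psi> w = (\<Sum>j=1..n. \<psi> j (subvec N U j w))"
    and w0: "w0 \<in> effective_domain \<Psi>" and i: "i \<in> {1..n}"
  shows "\<psi> i (subvec N U i w0) < \<infinity>"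
  using w0 i by (auto simp: effective_domain_def sep sum_Pinfty)

section \<open>The proximal coordinate step\<close>

text \<open>The midpoint of two distinct minimizers would have a strictly smaller value. Strictness
  comes from the real part \<open>q\<close>, which is why all values of \<open>g\<close> involved
  must first be shown finite.\<close>

lemma strictly_midconvex_arg_min_unique:
  fixes q :: "'a::real_vector \<Rightarrow> real" and g :: "'a \<Rightarrow> ereal"
  assumes q: "\<And>a b. a \<noteq> b \<Longrightarrow> q ((1/2) *\<^sub>R (a + b)) < (q a + q b) / 2"
    and g: "\<And>a b r s. g a = ereal r \<Longrightarrow> g b = ereal s \<Longrightarrow> g ((1/2) *\<^sub>R (a + b)) \<le> ereal ((r + s) / 2)"
    and g_ninf: "\<And>a. g a \<noteq> -\<infinity>" and g_dom: "g w0 < \<infinity>"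
    and a: "is_arg_min (\<lambda>w. ereal (q w) + g w) (\<lambda>w. True) a"
    and b: "is_arg_min (\<lambda>w. ereal (q w) + g w) (\<lambda>w. True) b"
  shows "a = b"
proof (rule ccontr)
  assume ne: "a \<noteq> b"
  have le: "ereal (q a) + g a \<le> ereal (q w) + g w" "ereal (q b) + g b \<le> ereal (q w) + g w" for w
    using a b unfolding is_arg_min_def by (auto simp: not_less)
  \<comment> \<open>Comparing with \<open>w0\<close>, where the objective is finite, rules out the
    value \<open>\<infinity>\<close> at a minimizer.\<close>
  obtain r where r: "g a = ereal r"
    using le(1)[of w0] g_dom g_ninf[of a] by (cases "g a"; cases "g w0") auto
  obtain s where s: "g b = ereal s"
    using le(2)[of w0] g_dom g_ninf[of b] by (cases "g b"; cases "g w0") auto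
  define m where "m = (1/2) *\<^sub>R (a + b)"
  obtain t where t: "g m = ereal t"
    using g[OF r s] g_ninf[of m] unfolding m_def[symmetric] by (cases "g m") auto
  have "t \<le> (r + s) / 2"
    using g[OF r s] t unfolding m_def by simp
  moreover have "q m < (q a + q b) / 2"
    using q[OF ne] unfolding m_def .
  moreover have "q a + r \<le> q m + t" "q b + s \<le> q m + t"
    using le[of m] r s t by auto
  ultimately show False
    by simp
qed

text \<open>Only the term for block \<open>i\<close> of the weighted norm competes with the rest of the objective, so
  the step in the whole space moves only block \<open>i\<close> away from \<open>c\<close>.\<close>

lemma proximal_block_step:
  fixes \<Psi> :: "real ^ 'N \<Rightarrow> ereal"
  assumes blocks: "block_permutation n N U"
    and proper: "proper_fun \<Psi>"
    and conv: "convex_fun \<Psi>"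
    and sep: "\<And>w. \<Psi> w = (\<Sum>j=1..n. \<psi> j (subvec N U j w))"
    and w0: "w0 \<in> effective_domain \<Psi>"
    and L_pos: "\<And>j. j \<in> {1..n} \<Longrightarrow> L j > 0"
    and i: "i \<in> {1..n}"
    and \<beta>: "\<beta> > 0"
    and z: "is_arg_min
              (\<lambda>w. ereal (\<beta> / 2 * (normL n N U L (w - c))\<^sup>2
                         + subvec N U i g \<bullet> (subvec N U i w - subvec N U i y))
                   + \<psi> i (subvec N U i w)) (\<lambda>w. True) z"
    and h: "is_arg_min
              (\<lambda>d. ereal (\<beta> * L i / 2 * (norm2 d)\<^sup>2 + subvec N U i g \<bullet> d)
                   + \<psi> i (subvec N U i c + d)) (\<lambda>d. d \<in> carrier_vec (N i)) h"
  shows "z = c + embed_block N U i h"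
proof -
  define q where "q w = \<beta> / 2 * (normL n N U L (w - c))\<^sup>2
      + subvec N U i g \<bullet> (subvec N U i w - subvec N U i y)" for w
  define p where "p d = \<beta> * L i / 2 * (norm2 d)\<^sup>2 + subvec N U i g \<bullet> d" for d
  \<comment> \<open>The price, independent of \<open>w\<close>, of moving the base point of the
    linear term from \<open>y\<close> to \<open>c\<close>.\<close>
  define K where "K = subvec N U i g \<bullet> subvec N U i (c - y)"
  have h_carrier: "h \<in> carrier_vec (N i)"
    using h unfolding is_arg_min_def by auto
  have lin: "subvec N U i g \<bullet> (subvec N U i w - subvec N U i y)
      = subvec N U i g \<bullet> subvec N U i (w - c) + K" for w
    unfolding K_def subvec_diff[symmetric] subvec_scalar_prod sum.distrib[symmetric]
    by (intro sum.cong refl) (simp add: inner_simps algebra_simps)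
  have embed: "subvec N U i (embed_block N U i h) = h"
    using subvec_embed_block[OF blocks i i h_carrier] by simp
  \<comment> \<open>Up to \<open>K\<close>, the block objective \<open>p\<close> bounds
    \<open>q\<close> from below, with equality at the embedded \<open>h\<close>. Hence minimality of
    \<open>h\<close> in its block makes \<open>c + embed_block N U i h\<close> a minimizer over the
    whole space, and only uniqueness remains.\<close>
  have q_h: "q (c + embed_block N U i h) = p h + K"
    using normL_sq_embed_block[where L = L, OF blocks L_pos i h_carrier]
    unfolding q_def p_def lin by (simp add: embed norm2_sq)
  have q_ge: "q w \<ge> p (subvec N U i (w - c)) + K" for w
    using normL_sq_ge_block[where L = L and n = n, OF L_pos i, of N U "w - c"] \<beta>
    unfolding q_def p_def lin by (simp add: norm2_sq)
  have "is_arg_min (\<lambda>w. ereal (q w) + \<psi> i (subvec N U i w)) (\<lambda>w. True) (c + embed_block N U i h)"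
    unfolding is_arg_min_linorder
  proof (intro conjI allI impI TrueI)
    fix w
    let ?d = "subvec N U i (w - c)"
    have d: "subvec N U i c + ?d = subvec N U i w"
      by (auto simp: inner_simps)
    have "ereal (p h) + \<psi> i (subvec N U i c + h) \<le> ereal (p ?d) + \<psi> i (subvec N U i c + ?d)"
      using h unfolding is_arg_min_linorder p_def by auto
    then have "ereal K + (ereal (p h) + \<psi> i (subvec N U i c + h))
        \<le> ereal K + (ereal (p ?d) + \<psi> i (subvec N U i w))"
      unfolding d by (rule add_left_mono)
    also have "\<dots> \<le> ereal (q w) + \<psi> i (subvec N U i w)"
      unfolding add.assoc[symmetric] using q_ge[of w] by (intro add_right_mono) simp
    finally show "ereal (q (c + embed_block N U i h)) + \<psi> i (subvec N U i (c + embed_block N U i h))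
        \<le> ereal (q w) + \<psi> i (subvec N U i w)"
      by (simp add: q_h subvec_add embed add.assoc[symmetric] add.commute)
  qed
  \<comment> \<open>The linear term is affine in \<open>w\<close> and contributes equality; the
    strict gain is the positive defect in the parallelogram law.\<close>
  moreover have "q ((1/2) *\<^sub>R (a + b)) < (q a + q b) / 2" if "a \<noteq> b" for a b
  proof -
    have "(1/2) *\<^sub>R (a + b) - c = (1/2) *\<^sub>R ((a - c) + (b - c))"
      by (simp add: scaleR_right_distrib scaleR_right_diff_distrib Finite_Cartesian_Product.vec_eq_iff)
    then have "(normL n N U L ((1/2) *\<^sub>R (a + b) - c))\<^sup>2
        = ((normL n N U L (a - c))\<^sup>2 + (normL n N U L (b - c))\<^sup>2) / 2 - (normL n N U L (a - b))\<^sup>2 / 4"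
      using normL_sq_midpoint[where L = L and n = n, OF L_pos, of N U "a - c" "b - c"] by simp
    moreover have "(normL n N U L (a - b))\<^sup>2 > 0"
      using normL_sq_pos[where L = L, OF blocks L_pos, of "a - b"] that by simp
    ultimately have "(normL n N U L ((1/2) *\<^sub>R (a + b) - c))\<^sup>2
        < ((normL n N U L (a - c))\<^sup>2 + (normL n N U L (b - c))\<^sup>2) / 2"
      by linarith
    then have "\<beta> / 2 * (normL n N U L ((1/2) *\<^sub>R (a + b) - c))\<^sup>2
        < \<beta> / 2 * (((normL n N U L (a - c))\<^sup>2 + (normL n N U L (b - c))\<^sup>2) / 2)"
      using \<beta> by (intro mult_strict_left_mono) auto
    moreover have "subvec N U i g \<bullet> (subvec N U i ((1/2) *\<^sub>R (a + b)) - subvec N U i y)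
        = (subvec N U i g \<bullet> (subvec N U i a - subvec N U i y)
           + subvec N U i g \<bullet> (subvec N U i b - subvec N U i y)) / 2"
      unfolding subvec_diff[symmetric] subvec_scalar_prod sum.distrib[symmetric] sum_divide_distrib
      by (intro sum.cong refl) (simp add: inner_simps field_simps)
    ultimately show ?thesis
      unfolding q_def by (simp add: field_simps)
  qed
  ultimately show ?thesis
    using z separable_term_midpoint[where \<psi> = \<psi>, OF blocks proper conv sep w0 i]
      separable_term_not_MInfty[where \<psi> = \<psi>, OF blocks proper sep w0 i]
      separable_term_not_PInfty[where \<psi> = \<psi>, OF sep w0 i]
    unfolding q_def[symmetric]
    by (intro strictly_midconvex_arg_min_unique[of q "\<lambda>w. \<psi> i (subvec N U i w)" w0]) auto
qed

section \<open>Equivalence of the two algorithms, by induction on the iteration\<close>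

theorem proposition1:
  fixes n :: nat and N :: "nat \<Rightarrow> nat" and U :: "nat \<Rightarrow> nat \<Rightarrow> real ^ 'N"
    and f :: "real ^ 'N \<Rightarrow> real" and G :: "real ^ 'N \<Rightarrow> real ^ 'N"
    and \<Psi> :: "real ^ 'N \<Rightarrow> ereal" and \<psi> :: "nat \<Rightarrow> real Matrix.vec \<Rightarrow> ereal"
    and L :: "nat \<Rightarrow> real" and \<mu> :: real
    and x0 :: "real ^ 'N" and i :: "nat \<Rightarrow> nat"
    and x y z u v :: "nat \<Rightarrow> real ^ 'N" and h :: "nat \<Rightarrow> real Matrix.vec"
  assumes blocks: "block_permutation n N U"
    and f_proper: "proper_fun (\<lambda>w. ereal (f w))"
    and f_lsc: "lsc_fun (\<lambda>w. ereal (f w))"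
    and f_convex: "convex_fun (\<lambda>w. ereal (f w))"
    and f_grad: "\<And>w. GDERIV f w :> G w"
    and Psi_proper: "proper_fun \<Psi>"
    and Psi_lsc: "lsc_fun \<Psi>"
    and Psi_convex: "convex_fun \<Psi>"
    and Psi_separable: "\<And>w. \<Psi> w = (\<Sum>j=1..n. \<psi> j (subvec N U j w))"
    and L_pos: "\<And>j. j \<in> {1..n} \<Longrightarrow> L j > 0"
    and L_lipschitz: "\<And>j w d. j \<in> {1..n} \<Longrightarrow> d \<in> carrier_vec (N j) \<Longrightarrow>
           norm2 (subvec N U j (G (w + embed_block N U j d)) - subvec N U j (G w)) \<le> L j * norm2 d"
    and mu_pos: "\<mu> > 0"
    and mu_convex: "\<And>w w'. w \<in> effective_domain \<Psi> \<Longrightarrow>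
           f w' \<ge> f w + inner (G w) (w' - w) + \<mu> / 2 * (normL n N U L (w' - w))\<^sup>2"
    and x0_dom: "x0 \<in> effective_domain \<Psi>"
    and indices: "\<And>k. i k \<in> {1..n}"
    and run_I: "algorithm_I n N U G \<psi> L \<mu> x0 i x y z"
    and run_II: "algorithm_II n N U G \<psi> L \<mu> x0 i h u v"
  shows "\<forall>k. x k = step_rho n \<mu> ^ k *\<^sub>R u k + v k \<and>
             y k = step_rho n \<mu> ^ (k + 1) *\<^sub>R u k + v k \<and>
             z k = - (step_rho n \<mu> ^ k *\<^sub>R u k) + v k"
proof -
  define \<alpha> where "\<alpha> = step_alpha n \<mu>"
  define \<rho> where "\<rho> = step_rho n \<mu>"
  have n: "n \<ge> 1"
    using indices[of 0] by simp
  have \<alpha>_pos: "\<alpha> > 0"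
    using mu_pos n by (simp add: \<alpha>_def step_alpha_def)
  \<comment> \<open>The starting point serves as the base point, being known to lie in the domain of
    \<open>\<Psi>\<close>. The bound becomes \<open>n * \<alpha> \<le> 1\<close> because
    \<open>n * \<alpha> = sqrt \<mu>\<close>.\<close>
  have "\<mu> \<le> 1"
    using convexity_parameter_le_1[OF blocks f_grad L_pos L_lipschitz mu_convex[OF x0_dom]] .
  then have n\<alpha>: "real n * \<alpha> \<le> 1"
    using n by (simp add: \<alpha>_def step_alpha_def)
  have \<rho>: "\<rho> * (1 + \<alpha>) = 1 - \<alpha>"
    using \<alpha>_pos by (simp add: \<rho>_def step_rho_def \<alpha>_def)
  have \<rho>0: "real n * \<alpha> = 1" if "\<rho> = 0"
  proof -
    have "\<alpha> = 1"
      using \<rho> that by simp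
    then show ?thesis
      using n n\<alpha> by simp
  qed
  have I: "x 0 = x0" "z 0 = x0"
    "y k = (1 / (1 + \<alpha>)) *\<^sub>R (x k + \<alpha> *\<^sub>R z k)"
    "is_arg_min
       (\<lambda>w. ereal (real n * \<alpha> / 2 * (normL n N U L (w - (1 - \<alpha>) *\<^sub>R z k - \<alpha> *\<^sub>R y k))\<^sup>2
                  + subvec N U (i k) (G (y k)) \<bullet> (subvec N U (i k) w - subvec N U (i k) (y k)))
            + \<psi> (i k) (subvec N U (i k) w)) (\<lambda>w. True) (z (Suc k))"
    "x (Suc k) = y k + (real n * \<alpha>) *\<^sub>R (z (Suc k) - z k) + (real n * \<alpha>\<^sup>2) *\<^sub>R (z k - y k)" for k
    using run_I unfolding algorithm_I_def Let_def \<alpha>_def by blast+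
  have II: "u 0 = 0" "v 0 = x0"
    "is_arg_min
       (\<lambda>d. ereal (real n * \<alpha> * L (i k) / 2 * (norm2 d)\<^sup>2
                  + subvec N U (i k) (G (\<rho> ^ Suc k *\<^sub>R u k + v k)) \<bullet> d)
            + \<psi> (i k) ((- (\<rho> ^ Suc k)) \<cdot>\<^sub>v subvec N U (i k) (u k) + subvec N U (i k) (v k) + d))
       (\<lambda>d. d \<in> carrier_vec (N (i k))) (h k)"
    "\<And>j. j \<in> {1..n} \<Longrightarrow> subvec N U j (u (Suc k)) =
       (if j = i k then subvec N U j (u k) - ((1 - real n * \<alpha>) / (2 * \<rho> ^ Suc k)) \<cdot>\<^sub>v h k
        else subvec N U j (u k))"
    "\<And>j. j \<in> {1..n} \<Longrightarrow> subvec N U j (v (Suc k)) =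
       (if j = i k then subvec N U j (v k) + ((1 + real n * \<alpha>) / 2) \<cdot>\<^sub>v h k
        else subvec N U j (v k))" for k
    using run_II unfolding algorithm_II_def Let_def \<alpha>_def \<rho>_def by blast+
  define H where "H k = embed_block N U (i k) (h k)" for k
  have h_carrier: "h k \<in> carrier_vec (N (i k))" for k
    using II(3)[of k] unfolding is_arg_min_def by auto
  have subvec_H: "subvec N U j (H k) = (if j = i k then h k else 0\<^sub>v (N j))" if "j \<in> {1..n}" for j k
    unfolding H_def using subvec_embed_block[OF blocks indices that h_carrier] .
  \<comment> \<open>\<open>H k\<close> vanishes outside block \<open>i k\<close>, so the case
    distinction in the update collapses to a single vector equation.\<close>
  have u_Suc: "u (Suc k) = u k - ((1 - real n * \<alpha>) / (2 * \<rho> ^ Suc k)) *\<^sub>R H k" for k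
    by (rule subvec_eqI[OF blocks])
       (simp only: subvec_diff subvec_scaleR subvec_H II(4), auto)
  have v_Suc: "v (Suc k) = v k + ((1 + real n * \<alpha>) / 2) *\<^sub>R H k" for k
    by (rule subvec_eqI[OF blocks])
       (simp only: subvec_add subvec_scaleR subvec_H II(5), auto)
  text \<open>For \<open>\<rho> = 0\<close> the junk value of the quotient is harmless, because then \<open>n \<alpha> = 1\<close>.\<close>
  have u_Suc': "\<rho> ^ Suc k *\<^sub>R u (Suc k) = \<rho> ^ Suc k *\<^sub>R u k - ((1 - real n * \<alpha>) / 2) *\<^sub>R H k" for k
    using \<rho>0 by (cases "\<rho> = 0") (simp_all add: u_Suc scaleR_right_diff_distrib)
  \<comment> \<open>The identity for \<open>y\<close> follows from those for \<open>x\<close> and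
    \<open>z\<close> at the same index, so the induction carries only the latter two.\<close>
  have y_eq: "y k = \<rho> ^ Suc k *\<^sub>R u k + v k"
    if "x k = \<rho> ^ k *\<^sub>R u k + v k" "z k = - (\<rho> ^ k *\<^sub>R u k) + v k" for k
  proof -
    have "x k + \<alpha> *\<^sub>R z k = ((1 - \<alpha>) * \<rho> ^ k) *\<^sub>R u k + (1 + \<alpha>) *\<^sub>R v k"
      unfolding that by (simp add: algebra_simps)
    also have "\<dots> = (1 + \<alpha>) *\<^sub>R (\<rho> ^ Suc k *\<^sub>R u k + v k)"
      unfolding \<rho>[symmetric] by (simp add: scaleR_right_distrib mult_ac)
    finally show ?thesis
      unfolding I(3)[of k] using \<alpha>_pos by simp
  qed
  have xz: "x k = \<rho> ^ k *\<^sub>R u k + v k \<and> z k = - (\<rho> ^ k *\<^sub>R u k) + v k" for k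
  proof (induction k)
    case 0
    show ?case by (simp add: I II)
  next
    case (Suc k)
    define r where "r = \<rho> ^ Suc k"
    define c where "c = - (r *\<^sub>R u k) + v k"
    have z: "z k = - (\<rho> ^ k *\<^sub>R u k) + v k" and y: "y k = r *\<^sub>R u k + v k"
      using Suc y_eq unfolding r_def by auto
    have c: "(1 - \<alpha>) *\<^sub>R z k + \<alpha> *\<^sub>R y k = c"
    proof -
      have "(1 - \<alpha>) *\<^sub>R z k + \<alpha> *\<^sub>R y k = (\<alpha> * r - (1 - \<alpha>) * \<rho> ^ k) *\<^sub>R u k + v k"
        unfolding z y by (simp add: algebra_simps)
      \<comment> \<open>With \<open>1 - \<alpha>\<close> replaced by
        \<open>\<rho> * (1 + \<alpha>)\<close>, the second product is
        \<open>(1 + \<alpha>) * r\<close>.\<close>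
      also have "\<alpha> * r - (1 - \<alpha>) * \<rho> ^ k = - r"
        unfolding r_def \<rho>[symmetric] by (simp add: algebra_simps)
      finally show ?thesis
        by (simp add: c_def)
    qed
    have c_subvec: "(- r) \<cdot>\<^sub>v subvec N U (i k) (u k) + subvec N U (i k) (v k) = subvec N U (i k) c"
      unfolding c_def by (auto simp: inner_simps)
    have z_Suc: "z (Suc k) = c + H k"
      unfolding H_def
    proof (rule proximal_block_step[OF blocks Psi_proper Psi_convex Psi_separable x0_dom L_pos indices])
      show "real n * \<alpha> > 0"
        using n \<alpha>_pos by simp
      show "is_arg_min
          (\<lambda>w. ereal (real n * \<alpha> / 2 * (normL n N U L (w - c))\<^sup>2
                     + subvec N U (i k) (G (y k)) \<bullet> (subvec N U (i k) w - subvec N U (i k) (y k)))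
               + \<psi> (i k) (subvec N U (i k) w)) (\<lambda>w. True) (z (Suc k))"
        using I(4)[of k] unfolding diff_diff_eq c .
      show "is_arg_min
          (\<lambda>d. ereal (real n * \<alpha> * L (i k) / 2 * (norm2 d)\<^sup>2 + subvec N U (i k) (G (y k)) \<bullet> d)
               + \<psi> (i k) (subvec N U (i k) c + d)) (\<lambda>d. d \<in> carrier_vec (N (i k))) (h k)"
        using II(3)[of k] unfolding r_def[symmetric] y[symmetric] c_subvec .
    qed
    have u_r: "r *\<^sub>R u (Suc k) = r *\<^sub>R u k - ((1 - real n * \<alpha>) / 2) *\<^sub>R H k"
      using u_Suc'[of k] unfolding r_def .
    \<comment> \<open>Multiplied by \<open>n * \<alpha>\<close>, the part along
      \<open>y k - z k\<close> cancels the correction term in step (3) of Algorithm I, leaving a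
      move along \<open>H k\<close> alone.\<close>
    have "z (Suc k) - z k = \<alpha> *\<^sub>R (y k - z k) + H k"
      unfolding z_Suc c[symmetric] by (simp add: algebra_simps)
    then have "x (Suc k) = y k + (real n * \<alpha>) *\<^sub>R H k"
      unfolding I(5)[of k] by (simp only:, simp add: algebra_simps power2_eq_square)
    \<comment> \<open>The step sizes of Algorithm II are made for this: the coefficients of
      \<open>H k\<close> from \<open>u\<close> and \<open>v\<close> are
      \<open>-(1 - n * \<alpha>) / 2\<close> and \<open>(1 + n * \<alpha>) / 2\<close>. Their sum is
      \<open>n * \<alpha>\<close>, as \<open>x\<close> requires; with the sign of \<open>u\<close>
      reversed it is 1, as \<open>z\<close> requires.\<close>
    also have "\<dots> = \<rho> ^ Suc k *\<^sub>R u (Suc k) + v (Suc k)"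
      unfolding r_def[symmetric] u_r v_Suc y
      by (simp add: Finite_Cartesian_Product.vec_eq_iff field_simps)
    finally have "x (Suc k) = \<rho> ^ Suc k *\<^sub>R u (Suc k) + v (Suc k)" .
    moreover have "z (Suc k) = - (\<rho> ^ Suc k *\<^sub>R u (Suc k)) + v (Suc k)"
      unfolding r_def[symmetric] u_r z_Suc c_def v_Suc
      by (simp add: Finite_Cartesian_Product.vec_eq_iff field_simps)
    ultimately show ?case ..
  qed
  show ?thesis
    using xz y_eq unfolding \<rho>_def by auto
qed

end
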